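(* Let $H$ be a locally compact group having a compact normal subgroup $K$ such that the quotient $H/K$ is discrete and countable. Then $H$ is isomorphic (as a topological group) to a closed subgroup of some locally compact group $G$ having a compact normal subgroup $L$ such that $G/L$ is discrete and finitely generated.
   Context: Locally compact groups are Hausdorff topological groups whose topology is locally compact. *)

theory Defs
  imports "HOL-Analysis.Analysis" "HOL-Algebra.Coset" "HOL-Algebra.Generated_Groups"
begin

text \<open>Topological groups are given by a group \<open>G\<close> together with an abstract topology \<open>T\<close> on its
  carrier. The Hausdorff condition is not part of this locale; it enters with
  \<open>locally_compact_group\<close>.\<close>

locale topological_group = group G for G (structure) +
  fixes T
  assumes topspace_eq: "topspace T = carrier G"
    and continuous_mult:
      "continuous_map (prod_topology T T) T (\<lambda>(x, y). x \<otimes> y)"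
    and continuous_inv: "continuous_map T T (\<lambda>x. inv x)"

locale locally_compact_group = topological_group +
  assumes Hausdorff: "Hausdorff_space T"
    and locally_compact: "locally_compact_space T"

definition quotient_group_topology ::
  "('a, 'b) monoid_scheme \<Rightarrow> 'a topology \<Rightarrow> 'a set \<Rightarrow> 'a set topology" where
  "quotient_group_topology G T N =
     topology (\<lambda>U. U \<subseteq> carrier (G Mod N) \<and> openin T {x \<in> carrier G. N #>\<^bsub>G\<^esub> x \<in> U})"

text \<open>The argument of \<open>topology\<close> above is indeed a topology, and it is the one for which the
  projection onto the quotient group is a quotient map.\<close>

lemma openin_quotient_group_topology:
  "openin (quotient_group_topology G T N) U \<longleftrightarrow>
     U \<subseteq> carrier (G Mod N) \<and> openin T {x \<in> carrier G. N #>\<^bsub>G\<^esub> x \<in> U}"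
proof -
  let ?P = "\<lambda>U. U \<subseteq> carrier (G Mod N) \<and> openin T {x \<in> carrier G. N #>\<^bsub>G\<^esub> x \<in> U}"
  have "istopology ?P"
    unfolding istopology_def
  proof (intro conjI allI impI)
    fix S S' assume S: "?P S" "?P S'"
    have "{x \<in> carrier G. N #>\<^bsub>G\<^esub> x \<in> S \<inter> S'} =
        {x \<in> carrier G. N #>\<^bsub>G\<^esub> x \<in> S} \<inter> {x \<in> carrier G. N #>\<^bsub>G\<^esub> x \<in> S'}"
      by blast
    then show "openin T {x \<in> carrier G. N #>\<^bsub>G\<^esub> x \<in> S \<inter> S'}"
      using S by (simp add: openin_Int)
    show "S \<inter> S' \<subseteq> carrier (G Mod N)"
      using S by blast
  next
    fix \<K> assume K: "\<forall>S\<in>\<K>. ?P S"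
    have "{x \<in> carrier G. N #>\<^bsub>G\<^esub> x \<in> \<Union>\<K>} =
        (\<Union>S\<in>\<K>. {x \<in> carrier G. N #>\<^bsub>G\<^esub> x \<in> S})"
      by blast
    then show "openin T {x \<in> carrier G. N #>\<^bsub>G\<^esub> x \<in> \<Union>\<K>}"
      using K by (auto intro!: openin_Union)
    show "\<Union>\<K> \<subseteq> carrier (G Mod N)"
      using K by blast
  qed
  then show ?thesis
    unfolding quotient_group_topology_def by (simp add: topology_inverse')
qed

lemma (in topological_group) topspace_quotient_group_topology:
  "topspace (quotient_group_topology G T N) = carrier (G Mod N)"
proof -
  have "{x \<in> carrier G. N #> x \<in> carrier (G Mod N)} = topspace T"
    by (auto simp: topspace_eq carrier_FactGroup)
  then have "openin (quotient_group_topology G T N) (carrier (G Mod N))"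
    by (simp add: openin_quotient_group_topology)
  then show ?thesis
    by (meson openin_quotient_group_topology openin_subset openin_topspace subset_antisym)
qed

lemma (in topological_group) quotient_map_quotient_group_topology:
  "quotient_map T (quotient_group_topology G T N) (\<lambda>x. N #> x)"
  unfolding quotient_map_def
  by (auto simp: topspace_quotient_group_topology openin_quotient_group_topology
      topspace_eq carrier_FactGroup)

definition discrete_quotient ::
  "('a, 'b) monoid_scheme \<Rightarrow> 'a topology \<Rightarrow> 'a set \<Rightarrow> bool" where
  "discrete_quotient G T N \<longleftrightarrow>
     quotient_group_topology G T N = discrete_topology (carrier (G Mod N))"

definition finitely_generated_group :: "('a, 'b) monoid_scheme \<Rightarrow> bool" where
  "finitely_generated_group G \<longleftrightarrow>
     (\<exists>S. finite S \<and> S \<subseteq> carrier G \<and> generate G S = carrier G)"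

definition topological_group_iso ::
  "('a, 'c) monoid_scheme \<Rightarrow> 'a topology \<Rightarrow> ('b, 'd) monoid_scheme \<Rightarrow> 'b topology \<Rightarrow>
   ('a \<Rightarrow> 'b) set" where
  "topological_group_iso G T G' T' = {f. f \<in> iso G G' \<and> homeomorphic_map T T' f}"

definition closed_subgroup ::
  "'a set \<Rightarrow> ('a, 'b) monoid_scheme \<Rightarrow> 'a topology \<Rightarrow> bool" where
  "closed_subgroup C G T \<longleftrightarrow> subgroup C G \<and> closedin T C"

text \<open>The existence of an ambient group can only be asserted over a fixed carrier type. For groups
  \<open>H\<close> over \<open>'a\<close> we use \<open>(nat \<Rightarrow> 'a) \<times> nat\<close>: the type has room for semidirect products of
  a countable power of a subgroup of \<open>H\<close> with a countable group.\<close>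

type_synonym 'a ambient = "(nat \<Rightarrow> 'a) \<times> nat"

end

theory Submission
  imports Defs "HOL-Algebra.Product_Groups" "HOL-Algebra.Weak_Morphisms"
begin

text \<open>The group \<open>G\<close> is a subgroup of the unrestricted permutational wreath product \<open>H\<^sup>X \<rtimes> P\<close>,
  where \<open>P\<close> is a countable group of permutations of a countable set \<open>X\<close>.  Its compact normal
  subgroup is \<open>L = K\<^sup>X\<close>, and \<open>G\<close> is generated by \<open>L\<close> together with three further elements, so that
  \<open>G/L\<close> is generated by the three images.  The group \<open>H\<close> sits in \<open>G\<close> as the functions supported at
  one point of \<open>X\<close>.

  The choice of the three generators is the algebraic heart (\<open>single_mem_subgroup\<close>).  Take
  \<open>X = \<int> \<times> \<int>\<close>, let \<open>s\<close> move each row \<open>i\<close> to row \<open>i + 1\<close>, and let \<open>t\<close> shift row \<open>0\<close> by one step and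
  fix all other rows.  Let \<open>r\<^sub>0, r\<^sub>1, \<dots>\<close> meet all cosets of \<open>K\<close>, and let \<open>f\<close> take the constant
  value \<open>r\<^sub>i\<close> on the right half of row \<open>i\<close> for \<open>i \<ge> 0\<close> and the value \<open>r\<^sub>0\<close> on the right half of
  each row \<open>i < 0\<close>, and be trivial on all left halves.  Conjugating
  \<open>f\<close> by \<open>s\<^sup>k\<close> brings the row with value \<open>r\<^sub>k\<close> to position \<open>0\<close>; shifting this row by one
  step changes the function only at the boundary point of the half row, so the commutator with
  \<open>t\<close> is \<open>r\<^sub>k\<close> concentrated at a single point.  Multiplying with elements of \<open>L\<close> yields every
  element of \<open>H\<close> at that point.

  For the topology, let \<open>G\<close> be any group with a normal subgroup \<open>L\<close> that carries a compact
  Hausdorff group topology.  Declaring the cosets of \<open>L\<close> open, with the topology of \<open>L\<close>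
  transported to them, makes \<open>G\<close> a locally compact group with \<open>L\<close> open as soon as
  conjugation by each element of \<open>G\<close> is continuous on \<open>L\<close>
  (\<open>locally_compact_group_ext\<close>).  Conjugation in the wreath product permutes the coordinates of
  \<open>K\<^sup>X\<close> and conjugates each of them by an element of \<open>H\<close>, hence is continuous for the
  product topology, which is compact by Tychonoff's theorem.  Finally \<open>H \<rightarrow> G\<close> is a closed embedding
  because on every coset of \<open>L\<close> it is, up to translation, the embedding of the compact group \<open>K\<close>
  as one factor of \<open>K\<^sup>X\<close> (\<open>closed_embedding_ext\<close>).\<close>

section \<open>Groups with a prescribed compact open normal subgroup\<close>

lemma (in topological_group) continuous_map_mult_right:
  assumes "a \<in> carrier G" shows "continuous_map T T (\<lambda>x. x \<otimes> a)"
proof -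
  have "continuous_map T (prod_topology T T) (\<lambda>x. (x, a))"
    using assms by (simp add: continuous_map_pairedI topspace_eq)
  from continuous_map_compose[OF this continuous_mult] show ?thesis
    by (simp add: o_def)
qed

lemma (in topological_group) continuous_map_mult_left:
  assumes "a \<in> carrier G" shows "continuous_map T T (\<lambda>x. a \<otimes> x)"
proof -
  have "continuous_map T (prod_topology T T) (\<lambda>x. (a, x))"
    using assms by (simp add: continuous_map_pairedI topspace_eq)
  from continuous_map_compose[OF this continuous_mult] show ?thesis
    by (simp add: o_def)
qed

lemma (in topological_group) openin_translate:
  assumes "openin T V" "a \<in> carrier G" shows "openin T ((\<lambda>x. x \<otimes> a) ` V)"
proof -
  have V: "V \<subseteq> carrier G"
    using assms(1) openin_subset topspace_eq by blast
  have "(\<lambda>x. x \<otimes> a) ` V = {x \<in> topspace T. x \<otimes> inv a \<in> V}"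
  proof (intro equalityI subsetI)
    fix y assume "y \<in> {x \<in> topspace T. x \<otimes> inv a \<in> V}"
    then have "y = (y \<otimes> inv a) \<otimes> a" "y \<otimes> inv a \<in> V"
      using assms(2) by (auto simp: m_assoc topspace_eq)
    then show "y \<in> (\<lambda>x. x \<otimes> a) ` V" by blast
  qed (use V assms(2) in \<open>auto simp: m_assoc topspace_eq\<close>)
  then show ?thesis
    using openin_continuous_map_preimage[OF continuous_map_mult_right[OF inv_closed[OF assms(2)]] assms(1)]
    by simp
qed

text \<open>A normal subgroup of \<open>G\<close> with a topology of its own, given as the image of an injective
  homomorphism \<open>\<iota>\<close>; this lets a power of \<open>K\<close> keep its native type of functions.  The last condition
  is the continuity of conjugation, written without inverses in \<open>G\<close> so that it passes directly
  to subgroups.  It also forces the image of \<open>\<iota>\<close> to be normal.\<close>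
locale compact_normal_embedding = group G + M: topological_group M S
  for G (structure) and M and S +
  fixes \<iota>
  assumes hom: "\<iota> \<in> hom M G"
    and inj: "inj_on \<iota> (carrier M)"
    and compact: "compact_space S"
    and Hausdorff: "Hausdorff_space S"
    and conj: "\<And>g. g \<in> carrier G \<Longrightarrow>
      \<exists>\<psi>. continuous_map S S \<psi> \<and> (\<forall>m\<in>carrier M. g \<otimes> \<iota> m = \<iota> (\<psi> m) \<otimes> g)"
begin

abbreviation L where "L \<equiv> \<iota> ` carrier M"

lemma \<iota>_closed [simp, intro]: "m \<in> carrier M \<Longrightarrow> \<iota> m \<in> carrier G"
  using hom by (auto simp: hom_def)

lemma \<iota>_mult: "m \<in> carrier M \<Longrightarrow> n \<in> carrier M \<Longrightarrow> \<iota> (m \<otimes>\<^bsub>M\<^esub> n) = \<iota> m \<otimes> \<iota> n"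
  using hom by (auto simp: hom_def)

lemma \<iota>_hom: "group_hom M G \<iota>"
  using hom by (simp add: group_hom_def group_hom_axioms_def M.is_group is_group)

lemma \<iota>_one [simp]: "\<iota> \<one>\<^bsub>M\<^esub> = \<one>"
  using group_hom.hom_one[OF \<iota>_hom] .

lemma \<iota>_inv: "m \<in> carrier M \<Longrightarrow> \<iota> (inv\<^bsub>M\<^esub> m) = inv (\<iota> m)"
  using group_hom.hom_inv[OF \<iota>_hom] .

lemma subgroup_L: "subgroup L G"
  using group_hom.subgroup_img_is_subgroup[OF \<iota>_hom M.subgroup_self] .

lemma normal_L: "L \<lhd> G"
  unfolding normal_inv_iff
proof (intro conjI ballI)
  fix x h assume x: "x \<in> carrier G" and "h \<in> L"
  then obtain m where m: "m \<in> carrier M" "h = \<iota> m" by blast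
  obtain \<psi> where \<psi>: "continuous_map S S \<psi>" "\<forall>m\<in>carrier M. x \<otimes> \<iota> m = \<iota> (\<psi> m) \<otimes> x"
    using conj[OF x] by blast
  have "\<psi> m \<in> carrier M"
    using \<psi>(1) m by (auto simp: continuous_map_def M.topspace_eq)
  then have "x \<otimes> h \<otimes> inv x = \<iota> (\<psi> m)"
    using \<psi>(2) m x by (simp add: m_assoc)
  then show "x \<otimes> h \<otimes> inv x \<in> L"
    using \<open>\<psi> m \<in> carrier M\<close> by blast
qed (rule subgroup_L)

text \<open>The topology on \<open>G\<close> in which every coset \<open>L w\<close> is open and carries the topology of \<open>M\<close>,
  transported along \<open>m \<mapsto> \<iota> m \<otimes> w\<close>.\<close>
definition ext_topology where
  "ext_topology = topology (\<lambda>U. U \<subseteq> carrier G \<and>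
     (\<forall>w\<in>carrier G. openin S {m \<in> carrier M. \<iota> m \<otimes> w \<in> U}))"

lemma openin_ext:
  "openin ext_topology U \<longleftrightarrow>
     U \<subseteq> carrier G \<and> (\<forall>w\<in>carrier G. openin S {m \<in> carrier M. \<iota> m \<otimes> w \<in> U})"
proof -
  let ?P = "\<lambda>U. U \<subseteq> carrier G \<and> (\<forall>w\<in>carrier G. openin S {m \<in> carrier M. \<iota> m \<otimes> w \<in> U})"
  have "istopology ?P"
    unfolding istopology_def
  proof (intro conjI allI impI ballI)
    fix A B w assume A: "?P A" and B: "?P B" and w: "w \<in> carrier G"
    have "{m \<in> carrier M. \<iota> m \<otimes> w \<in> A \<inter> B} =
        {m \<in> carrier M. \<iota> m \<otimes> w \<in> A} \<inter> {m \<in> carrier M. \<iota> m \<otimes> w \<in> B}" by blast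
    then show "openin S {m \<in> carrier M. \<iota> m \<otimes> w \<in> A \<inter> B}"
      using A B w by (simp add: openin_Int)
  next
    fix \<K> w assume K: "\<forall>A\<in>\<K>. ?P A" and w: "w \<in> carrier G"
    have "{m \<in> carrier M. \<iota> m \<otimes> w \<in> \<Union>\<K>} = (\<Union>A\<in>\<K>. {m \<in> carrier M. \<iota> m \<otimes> w \<in> A})" by blast
    then show "openin S {m \<in> carrier M. \<iota> m \<otimes> w \<in> \<Union>\<K>}"
      using K w by (auto intro!: openin_Union)
  qed blast+
  then show ?thesis
    unfolding ext_topology_def by (simp add: topology_inverse')
qed

lemma topspace_ext: "topspace ext_topology = carrier G"
proof -
  have "{m \<in> carrier M. \<iota> m \<otimes> w \<in> carrier G} = topspace S" if "w \<in> carrier G" for w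
    using that by (auto simp: M.topspace_eq)
  then have "openin ext_topology (carrier G)"
    by (auto simp: openin_ext)
  then show ?thesis
    by (meson openin_ext openin_subset openin_topspace subset_antisym)
qed

lemma closedin_ext:
  "closedin ext_topology D \<longleftrightarrow>
     D \<subseteq> carrier G \<and> (\<forall>w\<in>carrier G. closedin S {m \<in> carrier M. \<iota> m \<otimes> w \<in> D})"
proof -
  have "{m \<in> carrier M. \<iota> m \<otimes> w \<in> carrier G - D} =
      topspace S - {m \<in> carrier M. \<iota> m \<otimes> w \<in> D}" if "w \<in> carrier G" for w
    using that by (auto simp: M.topspace_eq)
  then show ?thesis
    by (auto simp: closedin_def openin_ext topspace_ext M.topspace_eq)
qed

text \<open>Two parametrizations of the same coset of \<open>L\<close> differ by a right translation of \<open>M\<close>.\<close>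
lemma coset_shift:
  assumes "w \<in> carrier G" "w' \<in> carrier G" "m \<in> carrier M" "n \<in> carrier M"
    and "\<iota> m \<otimes> w = \<iota> n \<otimes> w'" and "k \<in> carrier M"
  shows "\<iota> k \<otimes> w = \<iota> (k \<otimes>\<^bsub>M\<^esub> inv\<^bsub>M\<^esub> m \<otimes>\<^bsub>M\<^esub> n) \<otimes> w'"
proof -
  have "w = \<iota> (inv\<^bsub>M\<^esub> m) \<otimes> (\<iota> m \<otimes> w)"
    using assms(1,3) by (simp add: \<iota>_inv m_assoc[symmetric])
  also have "\<dots> = \<iota> (inv\<^bsub>M\<^esub> m) \<otimes> (\<iota> n \<otimes> w')" using assms(5) by simp
  finally have *: "w = \<iota> (inv\<^bsub>M\<^esub> m) \<otimes> (\<iota> n \<otimes> w')" .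
  show ?thesis
    by (subst *) (use assms in \<open>simp add: \<iota>_mult m_assoc\<close>)
qed

lemma continuous_map_coset:
  assumes "w \<in> carrier G" shows "continuous_map S ext_topology (\<lambda>m. \<iota> m \<otimes> w)"
  using assms by (auto simp: continuous_map_def topspace_ext M.topspace_eq openin_ext)

lemma openin_coset:
  assumes V: "openin S V" and w: "w \<in> carrier G"
  shows "openin ext_topology ((\<lambda>m. \<iota> m \<otimes> w) ` V)"
  unfolding openin_ext
proof (intro conjI ballI)
  have VM: "V \<subseteq> carrier M"
    using V openin_subset M.topspace_eq by blast
  then show "(\<lambda>m. \<iota> m \<otimes> w) ` V \<subseteq> carrier G"
    using w by blast
  fix w' assume w': "w' \<in> carrier G"
  let ?A = "{m \<in> carrier M. \<iota> m \<otimes> w' \<in> (\<lambda>m. \<iota> m \<otimes> w) ` V}"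
  show "openin S ?A"
  proof (cases "?A = {}")
    case False
    then obtain m n where mn: "m \<in> carrier M" "n \<in> V" "\<iota> m \<otimes> w' = \<iota> n \<otimes> w" by blast
    define a where "a = inv\<^bsub>M\<^esub> m \<otimes>\<^bsub>M\<^esub> n"
    have n: "n \<in> carrier M" using mn VM by blast
    have a: "a \<in> carrier M" using mn n by (simp add: a_def)
    have eq: "\<iota> k \<otimes> w' = \<iota> (k \<otimes>\<^bsub>M\<^esub> a) \<otimes> w" if "k \<in> carrier M" for k
      using coset_shift[OF w' w mn(1) n mn(3) that] that mn(1) n by (simp add: a_def M.m_assoc)
    have "?A = {k \<in> topspace S. k \<otimes>\<^bsub>M\<^esub> a \<in> V}"
    proof -
      have "\<iota> (k \<otimes>\<^bsub>M\<^esub> a) \<otimes> w \<in> (\<lambda>m. \<iota> m \<otimes> w) ` V \<longleftrightarrow> k \<otimes>\<^bsub>M\<^esub> a \<in> V" if "k \<in> carrier M" for k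
      proof
        assume "\<iota> (k \<otimes>\<^bsub>M\<^esub> a) \<otimes> w \<in> (\<lambda>m. \<iota> m \<otimes> w) ` V"
        then obtain v where v: "v \<in> V" "\<iota> (k \<otimes>\<^bsub>M\<^esub> a) \<otimes> w = \<iota> v \<otimes> w" by blast
        moreover have vM: "v \<in> carrier M" using v VM by blast
        ultimately have "\<iota> (k \<otimes>\<^bsub>M\<^esub> a) = \<iota> v"
          using right_cancel[OF w \<iota>_closed \<iota>_closed] that a M.m_closed by blast
        then have "k \<otimes>\<^bsub>M\<^esub> a = v"
          using inj that a vM by (auto dest: inj_onD)
        then show "k \<otimes>\<^bsub>M\<^esub> a \<in> V" using v by simp
      qed blast
      then show ?thesis by (simp add: eq M.topspace_eq cong: conj_cong)
    qed
    then show ?thesis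
      using openin_continuous_map_preimage[OF M.continuous_map_mult_right[OF a] V] by simp
  next
    case True then show ?thesis by (simp only: openin_empty)
  qed
qed

lemma compactin_coset:
  assumes "w \<in> carrier G" shows "compactin ext_topology ((\<lambda>m. \<iota> m \<otimes> w) ` carrier M)"
  using image_compactin[OF _ continuous_map_coset[OF assms], of "carrier M"] compact
  by (simp add: compact_space_def M.topspace_eq)

lemma compactin_L: "compactin ext_topology L"
proof -
  have "(\<lambda>m. \<iota> m \<otimes> \<one>) ` carrier M = L" by (intro image_cong) auto
  then show ?thesis using compactin_coset[OF one_closed] by simp
qed

lemma in_own_coset:
  assumes "openin S V" "\<one>\<^bsub>M\<^esub> \<in> V" "w \<in> carrier G"
  shows "w \<in> (\<lambda>m. \<iota> m \<otimes> w) ` V"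
  using assms by (force intro!: image_eqI[of _ _ "\<one>\<^bsub>M\<^esub>"])

lemma openin_carrier_M: "openin S (carrier M)"
  using M.topspace_eq openin_topspace by metis

text \<open>Near \<open>(x, y)\<close> multiplication is \<open>(m x) (n y) = (m \<cdot> x n x\<inverse>) (x y)\<close>, which only
  involves multiplication in \<open>M\<close> and conjugation by the fixed element \<open>x\<close>.\<close>
lemma continuous_mult_ext:
  "continuous_map (prod_topology ext_topology ext_topology) ext_topology (\<lambda>(x, y). x \<otimes> y)"
  unfolding continuous_map_def
proof (intro conjI allI impI)
  show "(\<lambda>(x, y). x \<otimes> y) \<in> topspace (prod_topology ext_topology ext_topology) \<rightarrow> topspace ext_topology"
    by (auto simp: topspace_ext)
  fix U assume U: "openin ext_topology U"
  show "openin (prod_topology ext_topology ext_topology)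
      {p \<in> topspace (prod_topology ext_topology ext_topology). (case p of (x, y) \<Rightarrow> x \<otimes> y) \<in> U}"
    unfolding openin_prod_topology_alt
  proof (intro allI impI)
    fix x y
    assume "(x, y) \<in> {p \<in> topspace (prod_topology ext_topology ext_topology).
        (case p of (x, y) \<Rightarrow> x \<otimes> y) \<in> U}"
    then have x: "x \<in> carrier G" and y: "y \<in> carrier G" and xy: "x \<otimes> y \<in> U"
      by (auto simp: topspace_ext)
    obtain \<psi> where \<psi>: "continuous_map S S \<psi>" "\<forall>m\<in>carrier M. x \<otimes> \<iota> m = \<iota> (\<psi> m) \<otimes> x"
      using conj[OF x] by blast
    have \<psi>M: "\<psi> m \<in> carrier M" if "m \<in> carrier M" for m
      using \<psi>(1) that by (auto simp: continuous_map_def M.topspace_eq)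
    have mult: "(\<iota> m \<otimes> x) \<otimes> (\<iota> n \<otimes> y) = \<iota> (m \<otimes>\<^bsub>M\<^esub> \<psi> n) \<otimes> (x \<otimes> y)"
      if "m \<in> carrier M" "n \<in> carrier M" for m n
    proof -
      have "(\<iota> m \<otimes> x) \<otimes> (\<iota> n \<otimes> y) = \<iota> m \<otimes> (x \<otimes> \<iota> n) \<otimes> y"
        using that x y by (simp add: m_assoc)
      also have "\<dots> = \<iota> m \<otimes> (\<iota> (\<psi> n) \<otimes> x) \<otimes> y" using \<psi>(2) that by simp
      finally show ?thesis using that x y \<psi>M by (simp add: \<iota>_mult m_assoc)
    qed
    have "continuous_map (prod_topology S S) (prod_topology S S) (\<lambda>p. (fst p, \<psi> (snd p)))"
      by (intro continuous_map_pairedI continuous_map_fst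
          continuous_map_compose[OF continuous_map_snd \<psi>(1), unfolded o_def])
    from continuous_map_compose[OF this M.continuous_mult]
    have cont: "continuous_map (prod_topology S S) S (\<lambda>p. fst p \<otimes>\<^bsub>M\<^esub> \<psi> (snd p))"
      by (simp add: o_def)
    define O' where "O' = {m \<in> carrier M. \<iota> m \<otimes> (x \<otimes> y) \<in> U}"
    have "openin S O'" using U x y by (simp add: O'_def openin_ext)
    from openin_continuous_map_preimage[OF cont this]
    have A: "openin (prod_topology S S) {p \<in> topspace (prod_topology S S). fst p \<otimes>\<^bsub>M\<^esub> \<psi> (snd p) \<in> O'}"
      (is "openin _ ?A") .
    have "(\<one>\<^bsub>M\<^esub>, \<one>\<^bsub>M\<^esub>) \<in> ?A"
      using x y xy \<psi>M mult[of "\<one>\<^bsub>M\<^esub>" "\<one>\<^bsub>M\<^esub>"] by (simp add: O'_def M.topspace_eq)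
    with A obtain V V' where V: "openin S V" "openin S V'" "\<one>\<^bsub>M\<^esub> \<in> V" "\<one>\<^bsub>M\<^esub> \<in> V'" "V \<times> V' \<subseteq> ?A"
      unfolding openin_prod_topology_alt by meson
    show "\<exists>W W'. openin ext_topology W \<and> openin ext_topology W' \<and> x \<in> W \<and> y \<in> W' \<and>
        W \<times> W' \<subseteq> {p \<in> topspace (prod_topology ext_topology ext_topology).
          (case p of (x, y) \<Rightarrow> x \<otimes> y) \<in> U}"
    proof (intro exI conjI)
      show "openin ext_topology ((\<lambda>m. \<iota> m \<otimes> x) ` V)" "openin ext_topology ((\<lambda>m. \<iota> m \<otimes> y) ` V')"
        using openin_coset V x y by auto
      show "x \<in> (\<lambda>m. \<iota> m \<otimes> x) ` V" "y \<in> (\<lambda>m. \<iota> m \<otimes> y) ` V'"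
        using in_own_coset V x y by auto
      have "(\<iota> m \<otimes> x) \<otimes> (\<iota> n \<otimes> y) \<in> U \<and> m \<in> carrier M \<and> n \<in> carrier M"
        if "m \<in> V" "n \<in> V'" for m n
      proof -
        have "(m, n) \<in> ?A" using V(5) that by blast
        then show ?thesis by (auto simp: O'_def mult M.topspace_eq)
      qed
      then show "(\<lambda>m. \<iota> m \<otimes> x) ` V \<times> (\<lambda>m. \<iota> m \<otimes> y) ` V' \<subseteq>
          {p \<in> topspace (prod_topology ext_topology ext_topology). (case p of (x, y) \<Rightarrow> x \<otimes> y) \<in> U}"
        using x y by (auto simp: topspace_ext)
    qed
  qed
qed

text \<open>Near \<open>w\<close> inversion is \<open>(m w)\<inverse> = (w\<inverse> m\<inverse> w) w\<inverse>\<close>, and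
  conjugation by \<open>w\<inverse>\<close> is continuous on \<open>M\<close>.\<close>
lemma continuous_inv_ext: "continuous_map ext_topology ext_topology (\<lambda>x. inv x)"
  unfolding continuous_map_def
proof (intro conjI allI impI)
  show "(\<lambda>x. inv x) \<in> topspace ext_topology \<rightarrow> topspace ext_topology"
    by (auto simp: topspace_ext)
  fix U assume U: "openin ext_topology U"
  show "openin ext_topology {x \<in> topspace ext_topology. inv x \<in> U}"
    unfolding openin_ext
  proof (intro conjI ballI)
    fix w assume w: "w \<in> carrier G"
    obtain \<psi> where \<psi>: "continuous_map S S \<psi>" "\<forall>m\<in>carrier M. inv w \<otimes> \<iota> m = \<iota> (\<psi> m) \<otimes> inv w"
      using conj[OF inv_closed[OF w]] by blast
    have "inv (\<iota> m \<otimes> w) = \<iota> (\<psi> (inv\<^bsub>M\<^esub> m)) \<otimes> inv w" if "m \<in> carrier M" for m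
    proof -
      have "inv (\<iota> m \<otimes> w) = inv w \<otimes> \<iota> (inv\<^bsub>M\<^esub> m)"
        using that w by (simp add: inv_mult_group \<iota>_inv)
      then show ?thesis using that \<psi>(2) by simp
    qed
    then have "{m \<in> carrier M. \<iota> m \<otimes> w \<in> {x \<in> topspace ext_topology. inv x \<in> U}} =
        {m \<in> topspace S. \<psi> (inv\<^bsub>M\<^esub> m) \<in> {m \<in> carrier M. \<iota> m \<otimes> inv w \<in> U}}"
      using w \<psi>(1) by (auto simp: topspace_ext M.topspace_eq continuous_map_def)
    moreover have "openin S {m \<in> carrier M. \<iota> m \<otimes> inv w \<in> U}"
      using U w by (simp add: openin_ext)
    ultimately show "openin S {m \<in> carrier M. \<iota> m \<otimes> w \<in> {x \<in> topspace ext_topology. inv x \<in> U}}"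
      using openin_continuous_map_preimage[OF
          continuous_map_compose[OF M.continuous_inv \<psi>(1), unfolded o_def]] by (simp only:)
  qed (auto simp: topspace_ext)
qed

text \<open>Points in different cosets of \<open>L\<close> are separated by these cosets; points in the same coset
  are separated there, since \<open>M\<close> is Hausdorff.\<close>
lemma Hausdorff_ext: "Hausdorff_space ext_topology"
  unfolding Hausdorff_space_def topspace_ext
proof (intro allI impI, elim conjE)
  fix x y assume x: "x \<in> carrier G" and y: "y \<in> carrier G" and xy: "x \<noteq> y"
  have ne: "disjnt ((\<lambda>m. \<iota> m \<otimes> x) ` V) ((\<lambda>m. \<iota> m \<otimes> y) ` V')"
    if "V \<subseteq> carrier M" "V' \<subseteq> carrier M"
      and "\<And>m n. m \<in> V \<Longrightarrow> n \<in> V' \<Longrightarrow> \<iota> m \<otimes> x \<noteq> \<iota> n \<otimes> y" for V V'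
    using that by (auto simp: disjnt_iff)
  show "\<exists>U V. openin ext_topology U \<and> openin ext_topology V \<and> x \<in> U \<and> y \<in> V \<and> disjnt U V"
  proof (cases "\<exists>l\<in>carrier M. y = \<iota> l \<otimes> x")
    case True
    then obtain l where l: "l \<in> carrier M" "y = \<iota> l \<otimes> x" by blast
    then have "l \<noteq> \<one>\<^bsub>M\<^esub>" using xy x by auto
    then obtain V V' where V: "openin S V" "openin S V'" "\<one>\<^bsub>M\<^esub> \<in> V" "l \<in> V'" "disjnt V V'"
      using Hausdorff l by (metis Hausdorff_space_def M.one_closed M.topspace_eq)
    have VM: "V \<subseteq> carrier M" "V' \<subseteq> carrier M"
      using V openin_subset M.topspace_eq by blast+
    show ?thesis
    proof (intro exI conjI)
      show "openin ext_topology ((\<lambda>m. \<iota> m \<otimes> x) ` V)" "openin ext_topology ((\<lambda>m. \<iota> m \<otimes> x) ` V')"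
        using openin_coset V x by auto
      show "x \<in> (\<lambda>m. \<iota> m \<otimes> x) ` V" using in_own_coset V x by auto
      show "y \<in> (\<lambda>m. \<iota> m \<otimes> x) ` V'" using l V by blast
      show "disjnt ((\<lambda>m. \<iota> m \<otimes> x) ` V) ((\<lambda>m. \<iota> m \<otimes> x) ` V')"
      proof -
        have "inj_on (\<lambda>m. \<iota> m \<otimes> x) (carrier M)"
          using x inj by (auto simp: inj_on_def)
        then have "(\<lambda>m. \<iota> m \<otimes> x) ` V \<inter> (\<lambda>m. \<iota> m \<otimes> x) ` V' = (\<lambda>m. \<iota> m \<otimes> x) ` (V \<inter> V')"
          using VM by (intro inj_on_image_Int[symmetric])
        then show ?thesis using V(5) by (simp add: disjnt_def)
      qed
    qed
  next
    case False
    have "\<iota> m \<otimes> x \<noteq> \<iota> n \<otimes> y" if "m \<in> carrier M" "n \<in> carrier M" for m n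
    proof
      assume "\<iota> m \<otimes> x = \<iota> n \<otimes> y"
      from coset_shift[OF y x that(2,1) this[symmetric] M.one_closed]
      have "y = \<iota> (\<one>\<^bsub>M\<^esub> \<otimes>\<^bsub>M\<^esub> inv\<^bsub>M\<^esub> n \<otimes>\<^bsub>M\<^esub> m) \<otimes> x" using y by simp
      then show False using False that by (metis M.inv_closed M.m_closed M.one_closed)
    qed
    then show ?thesis
      using openin_coset[OF openin_carrier_M x] openin_coset[OF openin_carrier_M y]
        in_own_coset[OF openin_carrier_M M.one_closed x] in_own_coset[OF openin_carrier_M M.one_closed y]
        ne[of "carrier M" "carrier M"] by blast
  qed
qed

lemma locally_compact_group_ext: "locally_compact_group G ext_topology"
proof unfold_locales
  show "locally_compact_space ext_topology"
    unfolding locally_compact_space_def topspace_ext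
  proof
    fix x assume x: "x \<in> carrier G"
    show "\<exists>U C. openin ext_topology U \<and> compactin ext_topology C \<and> x \<in> U \<and> U \<subseteq> C"
      using openin_coset[OF openin_carrier_M x] compactin_coset[OF x]
        in_own_coset[OF openin_carrier_M M.one_closed x] by blast
  qed
qed (simp_all only: topspace_ext continuous_mult_ext continuous_inv_ext Hausdorff_ext)

lemma discrete_quotient_ext: "discrete_quotient G ext_topology L"
  unfolding discrete_quotient_def
proof (rule topology_eq[THEN iffD2], intro allI)
  fix U
  have "openin ext_topology {x \<in> carrier G. L #> x \<in> U}"
    unfolding openin_ext
  proof (intro conjI ballI)
    fix w assume w: "w \<in> carrier G"
    have "L #> (\<iota> m \<otimes> w) = L #> w" if "m \<in> carrier M" for m
      using repr_independence[OF _ w subgroup_L, of "\<iota> m \<otimes> w"] that by (auto simp: r_coset_def)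
    then have "{m \<in> carrier M. \<iota> m \<otimes> w \<in> {x \<in> carrier G. L #> x \<in> U}} =
        (if L #> w \<in> U then carrier M else {})"
      using w by auto
    then show "openin S {m \<in> carrier M. \<iota> m \<otimes> w \<in> {x \<in> carrier G. L #> x \<in> U}}"
      using openin_carrier_M by simp
  qed blast
  then show "openin (quotient_group_topology G ext_topology L) U =
      openin (discrete_topology (carrier (G Mod L))) U"
    by (simp add: openin_quotient_group_topology)
qed

text \<open>Continuity of \<open>\<delta>\<close> need only be checked on the open subgroup \<open>K\<close>.  The map is closed
  because \<open>\<delta> ` C\<close> meets a coset of \<open>L\<close> either not at all, or in a translate of the image under
  \<open>\<kappa>\<close> of a closed, hence compact, subset of \<open>K\<close>; here it matters that only elements of \<open>K\<close> are
  mapped into \<open>L\<close>.\<close>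
lemma closed_embedding_ext:
  assumes H: "topological_group H T" and K: "openin T K" "compactin T K" "subgroup K H"
    and \<delta>: "\<delta> \<in> hom H G" "inj_on \<delta> (carrier H)"
    and \<kappa>: "continuous_map (subtopology T K) S \<kappa>" "\<And>k. k \<in> K \<Longrightarrow> \<delta> k = \<iota> (\<kappa> k)"
    and K_eq: "\<And>h. h \<in> carrier H \<Longrightarrow> \<delta> h \<in> L \<Longrightarrow> h \<in> K"
  shows "closed_subgroup (\<delta> ` carrier H) G ext_topology \<and>
    \<delta> \<in> topological_group_iso H T (G\<lparr>carrier := \<delta> ` carrier H\<rparr>)
          (subtopology ext_topology (\<delta> ` carrier H))"
proof -
  interpret H: topological_group H T by fact
  interpret \<delta>: group_hom H G \<delta>
    by (simp add: group_hom_def group_hom_axioms_def H.is_group is_group \<delta>)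
  have KH: "K \<subseteq> carrier H" using K(3) by (rule subgroup.subset)
  have \<kappa>M: "\<kappa> k \<in> carrier M" if "k \<in> K" for k
    using \<kappa>(1) that KH by (auto simp: continuous_map_def H.topspace_eq M.topspace_eq)
  have cont: "continuous_map T ext_topology \<delta>"
    unfolding continuous_map_def
  proof (intro conjI allI impI)
    show "\<delta> \<in> topspace T \<rightarrow> topspace ext_topology"
      by (auto simp: H.topspace_eq topspace_ext)
    fix U assume U: "openin ext_topology U"
    show "openin T {x \<in> topspace T. \<delta> x \<in> U}"
    proof (subst openin_subopen, intro ballI)
      fix h assume "h \<in> {x \<in> topspace T. \<delta> x \<in> U}"
      then have h: "h \<in> carrier H" "\<delta> h \<in> U" by (auto simp: H.topspace_eq)
      define V where "V = {k \<in> topspace (subtopology T K). \<kappa> k \<in> {m \<in> carrier M. \<iota> m \<otimes> \<delta> h \<in> U}}"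
      have "openin (subtopology T K) V"
        unfolding V_def using U h by (intro openin_continuous_map_preimage[OF \<kappa>(1)]) (simp add: openin_ext)
      then have "openin T V" using K(1) openin_trans_full by blast
      then have "openin T ((\<lambda>k. k \<otimes>\<^bsub>H\<^esub> h) ` V)" using h by (intro H.openin_translate)
      moreover have "h \<in> (\<lambda>k. k \<otimes>\<^bsub>H\<^esub> h) ` V"
      proof (rule image_eqI)
        have "\<one>\<^bsub>H\<^esub> \<in> K" using K(3) by (rule subgroup.one_closed)
        then show "\<one>\<^bsub>H\<^esub> \<in> V"
          using h \<kappa>(2)[of "\<one>\<^bsub>H\<^esub>", symmetric] \<kappa>M by (simp add: V_def H.topspace_eq)
      qed (use h in simp)
      moreover have "(\<lambda>k. k \<otimes>\<^bsub>H\<^esub> h) ` V \<subseteq> {x \<in> topspace T. \<delta> x \<in> U}"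
        using h \<kappa>(2) by (auto simp: V_def H.topspace_eq)
      ultimately show "\<exists>W. openin T W \<and> h \<in> W \<and> W \<subseteq> {x \<in> topspace T. \<delta> x \<in> U}" by blast
    qed
  qed
  have closed: "closed_map T ext_topology \<delta>"
    unfolding closed_map_def closedin_ext
  proof (intro allI impI conjI ballI)
    fix C assume C: "closedin T C"
    then have CH: "C \<subseteq> carrier H" using closedin_subset H.topspace_eq by blast
    then show "\<delta> ` C \<subseteq> carrier G" by auto
    fix w assume w: "w \<in> carrier G"
    \<comment> \<open>A nonempty trace on \<open>L w\<close> contains some \<open>\<delta> c\<close>, which serves as a new base point of the coset.\<close>
    let ?A = "{m \<in> carrier M. \<iota> m \<otimes> w \<in> \<delta> ` C}"
    show "closedin S ?A"
    proof (cases "?A = {}")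
      case True then show ?thesis by (simp only: closedin_empty)
    next
      case False
      then obtain m c where m: "m \<in> carrier M" and c: "c \<in> C" and mc: "\<iota> m \<otimes> w = \<delta> c" by blast
      have cH: "c \<in> carrier H" using c CH by blast
      define B where "B = {k \<in> K. k \<otimes>\<^bsub>H\<^esub> c \<in> C}"
      have eq: "\<iota> k \<otimes> w = \<iota> (k \<otimes>\<^bsub>M\<^esub> inv\<^bsub>M\<^esub> m) \<otimes> \<delta> c" if "k \<in> carrier M" for k
        using coset_shift[OF w \<delta>.hom_closed[OF cH] m M.one_closed _ that] that m cH mc by simp
      have "?A = {k \<in> topspace S. k \<otimes>\<^bsub>M\<^esub> inv\<^bsub>M\<^esub> m \<in> \<kappa> ` B}"
      proof -
        have "\<iota> a \<otimes> \<delta> c \<in> \<delta> ` C \<longleftrightarrow> a \<in> \<kappa> ` B" if a: "a \<in> carrier M" for a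
        proof
          assume "\<iota> a \<otimes> \<delta> c \<in> \<delta> ` C"
          then obtain d where d: "d \<in> C" "\<iota> a \<otimes> \<delta> c = \<delta> d" by blast
          have dH: "d \<in> carrier H" using d CH by blast
          have "\<delta> (d \<otimes>\<^bsub>H\<^esub> inv\<^bsub>H\<^esub> c) = \<iota> a"
            using d(2)[symmetric] cH dH a by (simp add: m_assoc)
          moreover from this have "d \<otimes>\<^bsub>H\<^esub> inv\<^bsub>H\<^esub> c \<in> K"
            using K_eq a cH dH by (metis H.inv_closed H.m_closed imageI)
          moreover from calculation have "\<kappa> (d \<otimes>\<^bsub>H\<^esub> inv\<^bsub>H\<^esub> c) = a"
            using \<kappa>(2) \<kappa>M inj a by (metis inj_onD)
          moreover have "(d \<otimes>\<^bsub>H\<^esub> inv\<^bsub>H\<^esub> c) \<otimes>\<^bsub>H\<^esub> c = d"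
            using cH dH by (simp add: H.m_assoc)
          ultimately show "a \<in> \<kappa> ` B" using d(1) unfolding B_def by (metis (mono_tags, lifting) imageI mem_Collect_eq)
        next
          assume "a \<in> \<kappa> ` B"
          then obtain b where b: "b \<in> K" "b \<otimes>\<^bsub>H\<^esub> c \<in> C" "a = \<kappa> b" by (auto simp: B_def)
          then have "\<iota> a \<otimes> \<delta> c = \<delta> (b \<otimes>\<^bsub>H\<^esub> c)"
            using \<kappa>(2) KH cH by (metis \<delta>.hom_mult subsetD)
          then show "\<iota> a \<otimes> \<delta> c \<in> \<delta> ` C" using b by blast
        qed
        then show ?thesis using m by (simp add: eq M.topspace_eq cong: conj_cong)
      qed
      moreover have "closedin S (\<kappa> ` B)"
      proof (rule compactin_imp_closedin[OF Hausdorff], rule image_compactin[OF _ \<kappa>(1)])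
        have "B = K \<inter> {x \<in> topspace T. x \<otimes>\<^bsub>H\<^esub> c \<in> C}"
          using KH by (auto simp: B_def H.topspace_eq)
        moreover have "closedin T {x \<in> topspace T. x \<otimes>\<^bsub>H\<^esub> c \<in> C}"
          by (rule closedin_continuous_map_preimage[OF H.continuous_map_mult_right[OF cH] C])
        ultimately have "compactin T B" using K(2) compact_Int_closedin by metis
        then show "compactin (subtopology T K) B"
          by (auto simp: compactin_subtopology B_def)
      qed
      ultimately show ?thesis
        using closedin_continuous_map_preimage[OF M.continuous_map_mult_right[OF M.inv_closed[OF m]]]
        by simp
    qed
  qed
  have "embedding_map T ext_topology \<delta>"
    using injective_closed_imp_embedding_map[OF cont closed] \<delta>(2) by (simp add: H.topspace_eq)
  then have "homeomorphic_map T (subtopology ext_topology (\<delta> ` carrier H)) \<delta>"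
    by (simp add: embedding_map_def H.topspace_eq)
  moreover have "\<delta> \<in> iso H (G\<lparr>carrier := \<delta> ` carrier H\<rparr>)"
    using \<delta> by (auto simp: iso_def hom_def bij_betw_def)
  moreover have "closedin ext_topology (\<delta> ` carrier H)"
    using closed by (metis H.topspace_eq closed_map_def closedin_topspace)
  moreover have "subgroup (\<delta> ` carrier H) G"
    by (rule \<delta>.subgroup_img_is_subgroup[OF H.subgroup_self])
  ultimately show ?thesis
    by (simp add: closed_subgroup_def topological_group_iso_def)
qed

end

section \<open>Subgroups and products of topological groups\<close>

lemma (in topological_group) topological_group_subgroup:
  assumes "subgroup K G" shows "topological_group (G\<lparr>carrier := K\<rparr>) (subtopology T K)"
proof -
  interpret K: group "G\<lparr>carrier := K\<rparr>"
    using assms by (rule subgroup_imp_group)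
  have KG: "K \<subseteq> carrier G" using assms by (rule subgroup.subset)
  show ?thesis
  proof unfold_locales
    show "topspace (subtopology T K) = carrier (G\<lparr>carrier := K\<rparr>)"
      using KG by (auto simp: topspace_eq)
    have "continuous_map (prod_topology (subtopology T K) (subtopology T K)) T (\<lambda>(x, y). x \<otimes> y)"
      using continuous_map_from_subtopology[OF continuous_mult, of "K \<times> K"]
      by (simp add: subtopology_Times)
    then show "continuous_map (prod_topology (subtopology T K) (subtopology T K)) (subtopology T K)
        (\<lambda>(x, y). x \<otimes>\<^bsub>G\<lparr>carrier := K\<rparr>\<^esub> y)"
      by (auto simp: continuous_map_in_subtopology subgroup.m_closed[OF assms])
    have "continuous_map (subtopology T K) (subtopology T K) (\<lambda>x. inv x)"
      using continuous_map_from_subtopology[OF continuous_inv]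
      by (auto simp: continuous_map_in_subtopology subgroup.m_inv_closed[OF assms])
    then show "continuous_map (subtopology T K) (subtopology T K) (\<lambda>x. inv\<^bsub>G\<lparr>carrier := K\<rparr>\<^esub> x)"
      by (rule continuous_map_eq) (simp add: m_inv_consistent[OF assms])
  qed
qed

lemma topological_group_product:
  assumes A: "\<And>i. i \<in> I \<Longrightarrow> topological_group (A i) (X i)"
  shows "topological_group (product_group I A) (product_topology X I)"
proof -
  have gr: "group (A i)" and sp: "topspace (X i) = carrier (A i)" if "i \<in> I" for i
    using A[OF that] by (auto simp: topological_group_def topological_group_axioms_def)
  interpret group "product_group I A" by (simp add: gr)
  have sp': "topspace (product_topology X I) = carrier (product_group I A)"
    by (auto simp: sp intro!: PiE_cong)
  show ?thesis
  proof unfold_locales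
    show "continuous_map (prod_topology (product_topology X I) (product_topology X I))
        (product_topology X I) (\<lambda>(x, y). x \<otimes>\<^bsub>product_group I A\<^esub> y)"
      unfolding continuous_map_componentwise
    proof (intro conjI ballI)
      fix i assume i: "i \<in> I"
      interpret A: topological_group "A i" "X i" using A[OF i] .
      have "continuous_map (prod_topology (product_topology X I) (product_topology X I))
          (prod_topology (X i) (X i)) (\<lambda>p. (fst p i, snd p i))"
        using i by (intro continuous_map_pairedI
            continuous_map_compose[OF continuous_map_fst continuous_map_product_projection, unfolded o_def]
            continuous_map_compose[OF continuous_map_snd continuous_map_product_projection, unfolded o_def])
      from continuous_map_compose[OF this A.continuous_mult]
      show "continuous_map (prod_topology (product_topology X I) (product_topology X I)) (X i)
          (\<lambda>x. (case x of (x, y) \<Rightarrow> x \<otimes>\<^bsub>product_group I A\<^esub> y) i)"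
        using i by (simp add: o_def case_prod_beta)
    qed auto
    have "continuous_map (product_topology X I) (product_topology X I)
        (\<lambda>x. \<lambda>i\<in>I. inv\<^bsub>A i\<^esub> x i)"
      unfolding continuous_map_componentwise
    proof (intro conjI ballI)
      fix i assume i: "i \<in> I"
      interpret A: topological_group "A i" "X i" using A[OF i] .
      show "continuous_map (product_topology X I) (X i) (\<lambda>x. (\<lambda>i\<in>I. inv\<^bsub>A i\<^esub> x i) i)"
        using i continuous_map_compose[OF continuous_map_product_projection[of i I X] A.continuous_inv]
        by (simp add: o_def)
    qed auto
    then show "continuous_map (product_topology X I) (product_topology X I)
        (\<lambda>x. inv\<^bsub>product_group I A\<^esub> x)"
    proof (rule continuous_map_eq)
      fix x assume "x \<in> topspace (product_topology X I)"
      then have "x \<in> (\<Pi>\<^sub>E i\<in>I. carrier (A i))" unfolding sp' by simp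
      then show "(\<lambda>i\<in>I. inv\<^bsub>A i\<^esub> x i) = inv\<^bsub>product_group I A\<^esub> x"
        by (simp add: gr)
    qed
  qed (rule sp')
qed

section \<open>Generating sets and countable permutation groups\<close>

lemma (in group) finitely_generated_Mod:
  assumes N: "N \<lhd> G" and S: "finite S" "S \<subseteq> carrier G" and gen: "carrier G = generate G (N \<union> S)"
  shows "finitely_generated_group (G Mod N)"
proof -
  interpret N: normal N G by fact
  interpret Q: group "G Mod N" by (rule N.factorgroup_is_group)
  let ?\<pi> = "\<lambda>x. N #> x"
  interpret \<pi>: group_hom G "G Mod N" ?\<pi>
    using N.r_coset_hom_Mod by unfold_locales
  have SQ: "?\<pi> ` S \<subseteq> carrier (G Mod N)" using S by auto
  have NS: "N \<union> S \<subseteq> carrier G" using S N.subset by auto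
  have "?\<pi> x \<in> generate (G Mod N) (?\<pi> ` S)" if "x \<in> N \<union> S" for x
  proof (cases "x \<in> N")
    case True
    then have "?\<pi> x = \<one>\<^bsub>G Mod N\<^esub>"
      using coset_join2[OF _ N.subgroup_axioms] N.subset by auto
    then show ?thesis using generate.one[of "G Mod N"] by simp
  qed (use that in \<open>auto intro: generate.incl\<close>)
  then have "generate (G Mod N) (?\<pi> ` (N \<union> S)) \<subseteq> generate (G Mod N) (?\<pi> ` S)"
    by (intro Q.generate_subgroup_incl Q.generate_is_subgroup SQ) auto
  moreover have "generate (G Mod N) (?\<pi> ` (N \<union> S)) = carrier (G Mod N)"
    using \<pi>.generate_img[OF NS] gen by (simp add: carrier_FactGroup)
  ultimately have "generate (G Mod N) (?\<pi> ` S) = carrier (G Mod N)"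
    using Q.generate_incl[OF SQ] by blast
  then show ?thesis
    unfolding finitely_generated_group_def using S(1) SQ by blast
qed

text \<open>Every element of the generated subgroup is the value of a finite word in the letters of \<open>S\<close>
  and their inverses; the Boolean of a letter tells whether it is inverted.\<close>
lemma (in group) countable_generate:
  assumes "countable S" "S \<subseteq> carrier G"
  shows "countable (generate G S)"
proof -
  define ev where "ev ws = foldr (\<lambda>w y. (if fst w then snd w else inv (snd w)) \<otimes> y) ws \<one>" 
    for ws :: "(bool \<times> 'a) list"
  let ?W = "UNIV \<times> S"
  have mem: "ev ws \<in> carrier G" if "set ws \<subseteq> ?W" for ws
    using that assms(2) by (induction ws) (auto simp: ev_def)
  have app: "ev (us @ ws) = ev us \<otimes> ev ws" if "set us \<subseteq> ?W" "set ws \<subseteq> ?W" for us ws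
    using that
  proof (induction us)
    case Nil then show ?case using mem[of ws] by (simp add: ev_def)
  next
    case (Cons u us)
    then show ?case using mem[of ws] mem[of us] assms(2) by (auto simp: ev_def m_assoc)
  qed
  have "x \<in> ev ` lists ?W" if "x \<in> generate G S" for x
    using that
  proof induction
    case one
    show ?case by (rule image_eqI[of _ _ "[]"]) (auto simp: ev_def)
  next
    case (incl h)
    then show ?case using assms(2) by (intro image_eqI[of _ _ "[(True, h)]"]) (auto simp: ev_def)
  next
    case (inv h)
    then show ?case using assms(2) by (intro image_eqI[of _ _ "[(False, h)]"]) (auto simp: ev_def)
  next
    case (eng g h)
    then obtain us ws where "us \<in> lists ?W" "ws \<in> lists ?W" "g = ev us" "h = ev ws" by blast
    then show ?case
      by (intro image_eqI[of _ _ "us @ ws"]) (auto simp: app lists_eq_set)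
  qed
  then have "generate G S \<subseteq> ev ` lists ?W" by blast
  moreover have "countable (ev ` lists ?W)"
    using assms by (intro countable_image countable_lists countable_SIGMA) auto
  ultimately show ?thesis by (rule countable_subset)
qed

lemma (in subgroup) mem_of_mult_eq:
  assumes "group G" "a \<in> carrier G" "b \<in> H" "c \<in> H" "a \<otimes> b = c" shows "a \<in> H"
proof -
  interpret group G by fact
  have "a = c \<otimes> inv b" using assms by (metis inv_solve_right mem_carrier)
  then show ?thesis using assms by simp
qed

text \<open>The group generated by countably many permutations is countable, so its elements can be
  renamed to natural numbers.  It acts from the right, that is, the product is composition in the
  opposite order; this is what makes \<open>f \<mapsto> (\<lambda>x. f (act p x))\<close> a left action on functions.\<close>
lemma ex_countable_permutation_action:
  fixes A :: "('x \<Rightarrow> 'x) set"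
  assumes A: "countable A" "\<And>g. g \<in> A \<Longrightarrow> bij g"
  obtains P :: "nat monoid" and act where "group P"
    and "\<And>p q. p \<in> carrier P \<Longrightarrow> q \<in> carrier P \<Longrightarrow> act (p \<otimes>\<^bsub>P\<^esub> q) = act q \<circ> act p"
    and "act \<one>\<^bsub>P\<^esub> = id" and "A \<subseteq> act ` carrier P"
proof -
  define Sym :: "('x \<Rightarrow> 'x) monoid"
    where "Sym = \<lparr>carrier = {g. bij g}, mult = (\<lambda>g h. h \<circ> g), one = id\<rparr>"
  interpret Sym: group Sym
  proof (rule groupI)
    fix g assume "g \<in> carrier Sym"
    then have "Hilbert_Choice.inv g \<in> carrier Sym" "Hilbert_Choice.inv g \<otimes>\<^bsub>Sym\<^esub> g = \<one>\<^bsub>Sym\<^esub>"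
      by (auto simp: Sym_def bij_imp_bij_inv surj_iff[symmetric] bij_is_surj)
    then show "\<exists>h\<in>carrier Sym. h \<otimes>\<^bsub>Sym\<^esub> g = \<one>\<^bsub>Sym\<^esub>" by blast
  qed (auto simp: Sym_def bij_comp o_assoc)
  define \<Gamma> where "\<Gamma> = generate Sym A"
  have AS: "A \<subseteq> carrier Sym" using A by (auto simp: Sym_def)
  have sub: "subgroup \<Gamma> Sym" unfolding \<Gamma>_def by (rule Sym.generate_is_subgroup[OF AS])
  have inj: "inj_on (to_nat_on \<Gamma>) \<Gamma>"
    unfolding \<Gamma>_def by (intro inj_on_to_nat_on Sym.countable_generate A AS)
  define \<Gamma>' where "\<Gamma>' = Sym\<lparr>carrier := \<Gamma>\<rparr>"
  interpret \<Gamma>': group \<Gamma>' unfolding \<Gamma>'_def by (rule Sym.subgroup_imp_group[OF sub])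
  define P where "P = image_group (to_nat_on \<Gamma>) \<Gamma>'"
  define act where "act = inv_into \<Gamma> (to_nat_on \<Gamma>)"
  have act: "act (to_nat_on \<Gamma> g) = g" if "g \<in> \<Gamma>" for g
    using inj that by (simp add: act_def)
  have carr: "carrier P = to_nat_on \<Gamma> ` \<Gamma>" by (simp add: P_def image_group_def \<Gamma>'_def)
  show thesis
  proof
    show "group P"
      unfolding P_def using inj by (intro \<Gamma>'.inj_imp_image_group_is_group) (simp add: \<Gamma>'_def)
    show "act \<one>\<^bsub>P\<^esub> = id"
      using act[OF subgroup.one_closed[OF sub]] by (simp add: P_def image_group_def \<Gamma>'_def Sym_def)
    show "A \<subseteq> act ` carrier P"
    proof
      fix g assume "g \<in> A"
      then have "g \<in> \<Gamma>" unfolding \<Gamma>_def by (rule generate.incl)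
      then show "g \<in> act ` carrier P" using act carr by force
    qed
    fix p q assume "p \<in> carrier P" "q \<in> carrier P"
    then have "act p \<in> \<Gamma>" "act q \<in> \<Gamma>" using act carr by auto
    from act[OF subgroup.m_closed[OF sub this]]
    show "act (p \<otimes>\<^bsub>P\<^esub> q) = act q \<circ> act p"
      by (simp add: P_def image_group_def \<Gamma>'_def Sym_def act_def)
  qed
qed

section \<open>Unrestricted permutational wreath products\<close>

text \<open>The action of \<open>P\<close> on \<open>X\<close> is a right action, so no inverse occurs in the
  multiplication.\<close>
definition wreath_product ::
  "('a, 'c) monoid_scheme \<Rightarrow> ('p, 'd) monoid_scheme \<Rightarrow> ('p \<Rightarrow> 'x \<Rightarrow> 'x) \<Rightarrow> (('x \<Rightarrow> 'a) \<times> 'p) monoid"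
  where "wreath_product H P act =
    \<lparr>carrier = {f. \<forall>x. f x \<in> carrier H} \<times> carrier P,
     mult = (\<lambda>(f, p) (g, q). (\<lambda>x. f x \<otimes>\<^bsub>H\<^esub> g (act p x), p \<otimes>\<^bsub>P\<^esub> q)),
     one = (\<lambda>_. \<one>\<^bsub>H\<^esub>, \<one>\<^bsub>P\<^esub>)\<rparr>"

locale wreath = H: group H + P: group P for H :: "('a, 'c) monoid_scheme" and P :: "('p, 'd) monoid_scheme" +
  fixes act :: "'p \<Rightarrow> 'x \<Rightarrow> 'x"
  assumes act_mult: "p \<in> carrier P \<Longrightarrow> q \<in> carrier P \<Longrightarrow> act (p \<otimes>\<^bsub>P\<^esub> q) = act q \<circ> act p"
    and act_one: "act \<one>\<^bsub>P\<^esub> = id"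
begin

abbreviation W where "W \<equiv> wreath_product H P act"

lemma mem_W [simp]: "(f, p) \<in> carrier W \<longleftrightarrow> (\<forall>x. f x \<in> carrier H) \<and> p \<in> carrier P"
  by (simp add: wreath_product_def)

lemma mult_W [simp]:
  "(f, p) \<otimes>\<^bsub>W\<^esub> (g, q) = (\<lambda>x. f x \<otimes>\<^bsub>H\<^esub> g (act p x), p \<otimes>\<^bsub>P\<^esub> q)"
  by (simp add: wreath_product_def)

lemma one_W [simp]: "\<one>\<^bsub>W\<^esub> = (\<lambda>_. \<one>\<^bsub>H\<^esub>, \<one>\<^bsub>P\<^esub>)"
  by (simp add: wreath_product_def)

sublocale W: group W
proof (rule groupI)
  fix a assume "a \<in> carrier W"
  then obtain f p where a: "a = (f, p)" "\<forall>x. f x \<in> carrier H" "p \<in> carrier P"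
    by (cases a) auto
  have "act p (act (inv\<^bsub>P\<^esub> p) x) = x" for x
    using act_mult[of "inv\<^bsub>P\<^esub> p" p] a by (simp add: act_one fun_eq_iff)
  then have "(\<lambda>x. inv\<^bsub>H\<^esub> f (act (inv\<^bsub>P\<^esub> p) x), inv\<^bsub>P\<^esub> p) \<in> carrier W"
    "(\<lambda>x. inv\<^bsub>H\<^esub> f (act (inv\<^bsub>P\<^esub> p) x), inv\<^bsub>P\<^esub> p) \<otimes>\<^bsub>W\<^esub> a = \<one>\<^bsub>W\<^esub>"
    using a by auto
  then show "\<exists>b\<in>carrier W. b \<otimes>\<^bsub>W\<^esub> a = \<one>\<^bsub>W\<^esub>" by blast
next
  fix a b c assume "a \<in> carrier W" "b \<in> carrier W" "c \<in> carrier W"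
  then show "a \<otimes>\<^bsub>W\<^esub> b \<otimes>\<^bsub>W\<^esub> c = a \<otimes>\<^bsub>W\<^esub> (b \<otimes>\<^bsub>W\<^esub> c)"
    by (cases a; cases b; cases c) (auto simp: act_mult H.m_assoc P.m_assoc)
next
  fix a b assume "a \<in> carrier W" "b \<in> carrier W"
  then show "a \<otimes>\<^bsub>W\<^esub> b \<in> carrier W" by (cases a; cases b) auto
next
  fix a assume "a \<in> carrier W"
  then show "\<one>\<^bsub>W\<^esub> \<otimes>\<^bsub>W\<^esub> a = a" by (cases a) (auto simp: act_one)
qed auto

definition base :: "('x \<Rightarrow> 'a) \<Rightarrow> ('x \<Rightarrow> 'a) \<times> 'p" where "base f = (f, \<one>\<^bsub>P\<^esub>)"

definition single where "single z h = base ((\<lambda>_. \<one>\<^bsub>H\<^esub>)(z := h))"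

lemma single_hom: "single z \<in> hom H W"
  by (auto simp: hom_def single_def base_def act_one fun_eq_iff)

lemma inj_single: "inj_on (single z) (carrier H)"
  by (auto simp: inj_on_def single_def base_def fun_eq_iff split: if_splits)

text \<open>The bijection \<open>e\<close> gives the index set coordinates in \<open>\<int> \<times> \<int>\<close>.  Conjugation by \<open>s\<close> turns \<open>f\<close> into
  functions \<open>g k\<close> whose row \<open>0\<close> has the value \<open>r k\<close> to the right of the origin.  As \<open>t\<close> shifts
  that row only, \<open>g k\<close> and its conjugate by \<open>t\<close> agree away from the origin, where their values
  are \<open>\<one>\<close> and \<open>r k\<close>.\<close>
lemma single_mem_subgroup:
  fixes e :: "int \<times> int \<Rightarrow> 'x" and r :: "nat \<Rightarrow> 'a"
  assumes e: "bij e" and st: "s \<in> carrier P" "t \<in> carrier P"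
    and s: "\<And>i n. act s (e (i, n)) = e (i + 1, n)"
    and t: "\<And>i n. act t (e (i, n)) = e (i, if i = 0 then n + 1 else n)"
    and r: "\<And>i. r i \<in> carrier H"
    and f: "\<And>i n. f (e (i, n)) = (if n > 0 then r (nat i) else \<one>\<^bsub>H\<^esub>)"
    and D: "subgroup D W" "base f \<in> D" "(\<lambda>_. \<one>\<^bsub>H\<^esub>, s) \<in> D" "(\<lambda>_. \<one>\<^bsub>H\<^esub>, t) \<in> D"
  shows "single (e (0, 0)) (r k) \<in> D"
proof -
  interpret D: subgroup D W by fact
  have ext: "f1 = f2" if "\<And>i n. f1 (e (i, n)) = f2 (e (i, n))" for f1 f2 :: "'x \<Rightarrow> 'a"
  proof
    fix x
    obtain y where "x = e y" using e by (meson bij_pointE)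
    then show "f1 x = f2 x" using that by (cases y) auto
  qed
  have e_eq: "e y = e z \<longleftrightarrow> y = z" for y z using e by (meson bij_def inj_eq)
  define g where "g k x = (case Hilbert_Choice.inv e x of (i, n) \<Rightarrow> if n > 0 then r (nat (int k + i)) else \<one>\<^bsub>H\<^esub>)"
    for k x
  have g: "g k (e (i, n)) = (if n > 0 then r (nat (int k + i)) else \<one>\<^bsub>H\<^esub>)" for k i n
    using e by (simp add: g_def bij_def)
  have gH: "g k x \<in> carrier H" for k x
    using r by (simp add: g_def split: prod.split)
  have gD: "base (g k) \<in> D" for k
  proof (induction k)
    case 0
    have "g 0 = f" by (rule ext) (simp add: f g)
    then show ?case using D by simp
  next
    case (Suc k)
    have "g (Suc k) = (\<lambda>x. g k (act s x))"
      by (rule ext) (simp add: s g algebra_simps)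
    then have "base (g (Suc k)) \<otimes>\<^bsub>W\<^esub> (\<lambda>_. \<one>\<^bsub>H\<^esub>, s) = (\<lambda>_. \<one>\<^bsub>H\<^esub>, s) \<otimes>\<^bsub>W\<^esub> base (g k)"
      using st gH by (simp add: base_def)
    moreover have "base (g (Suc k)) \<in> carrier W" using gH by (simp add: base_def)
    ultimately show ?case
      by (intro D.mem_of_mult_eq[OF W.is_group _ D(3) D.m_closed[OF D(3) Suc]])
  qed
  have "(\<lambda>x. ((\<lambda>_. \<one>\<^bsub>H\<^esub>)(e (0, 0) := r k)) x \<otimes>\<^bsub>H\<^esub> g k x) = (\<lambda>x. g k (act t x))"
    by (rule ext) (simp add: t g e_eq r fun_upd_def)
  then have "single (e (0, 0)) (r k) \<otimes>\<^bsub>W\<^esub> (base (g k) \<otimes>\<^bsub>W\<^esub> (\<lambda>_. \<one>\<^bsub>H\<^esub>, t)) =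
      (\<lambda>_. \<one>\<^bsub>H\<^esub>, t) \<otimes>\<^bsub>W\<^esub> base (g k)"
    using st gH by (simp add: base_def single_def act_one)
  moreover have "single (e (0, 0)) (r k) \<in> carrier W"
    using r by (simp add: single_def base_def)
  ultimately show ?thesis
    by (intro D.mem_of_mult_eq[OF W.is_group _ D.m_closed[OF gD D(4)] D.m_closed[OF D(4) gD]])
qed

end

section \<open>Powers of a compact normal subgroup in the wreath product\<close>

lemma (in topological_group) continuous_map_conjugation_subgroup:
  assumes "K \<lhd> G" and a: "a \<in> carrier G"
  shows "continuous_map (subtopology T K) (subtopology T K) (\<lambda>k. a \<otimes> k \<otimes> inv a)"
proof -
  have "continuous_map T T (\<lambda>k. a \<otimes> k \<otimes> inv a)"
    using continuous_map_compose[OF continuous_map_mult_left[OF a] continuous_map_mult_right[OF inv_closed[OF a]]]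
    by (simp add: o_def)
  moreover have "a \<otimes> k \<otimes> inv a \<in> K" if "k \<in> K" for k
    using assms that by (simp add: normal_inv_iff)
  ultimately show ?thesis
    by (auto simp: continuous_map_in_subtopology intro: continuous_map_from_subtopology)
qed

lemma (in topological_group) openin_of_discrete_quotient:
  assumes "subgroup K G" and "discrete_quotient G T K"
  shows "openin T K"
proof -
  have "{K} \<subseteq> carrier (G Mod K)"
    using coset_join2[OF one_closed assms(1) subgroup.one_closed[OF assms(1)]]
    by (auto simp: carrier_FactGroup image_iff intro!: bexI[of _ \<one>])
  then have "openin (quotient_group_topology G T K) {K}"
    using assms(2) by (simp add: discrete_quotient_def)
  moreover have "{x \<in> carrier G. K #> x \<in> {K}} = K"
    using coset_join1[OF _ _ assms(1)] coset_join2[OF _ assms(1)] subgroup.subset[OF assms(1)] by auto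
  ultimately show ?thesis
    by (simp add: openin_quotient_group_topology)
qed

text \<open>Conjugation by \<open>(f, p)\<close> sends \<open>m\<close> to \<open>x \<mapsto> f x \<otimes> m (act p x) \<otimes> inv (f x)\<close>.  Each
  coordinate of the result depends continuously on a single coordinate of \<open>m\<close>, for arbitrary \<open>f\<close>;
  this is why the full, unrestricted power of \<open>H\<close> can be used.\<close>
lemma (in wreath) compact_normal_embedding_base:
  assumes top: "topological_group H T" "Hausdorff_space T" and K: "K \<lhd> H" "compactin T K"
    and D: "subgroup D W" "\<And>m. (\<And>x. m x \<in> K) \<Longrightarrow> base m \<in> D"
  shows "compact_normal_embedding (W\<lparr>carrier := D\<rparr>)
    (product_group UNIV (\<lambda>_::'x. H\<lparr>carrier := K\<rparr>)) (product_topology (\<lambda>_::'x. subtopology T K) UNIV) base"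
proof -
  interpret topological_group H T by fact
  have sK: "subgroup K H" using K(1) by (rule normal_imp_subgroup)
  have KH: "K \<subseteq> carrier H" using sK by (rule subgroup.subset)
  interpret M: topological_group "product_group UNIV (\<lambda>_::'x. H\<lparr>carrier := K\<rparr>)"
    "product_topology (\<lambda>_. subtopology T K) UNIV"
    by (intro topological_group_product topological_group_subgroup sK)
  interpret G: group "W\<lparr>carrier := D\<rparr>" using D(1) by (rule W.subgroup_imp_group)
  show ?thesis
  proof unfold_locales
    show "base \<in> hom (product_group UNIV (\<lambda>_::'x. H\<lparr>carrier := K\<rparr>)) (W\<lparr>carrier := D\<rparr>)"
      using D(2) by (auto simp: hom_def base_def act_one PiE_iff)
    show "inj_on base (carrier (product_group UNIV (\<lambda>_::'x. H\<lparr>carrier := K\<rparr>)))"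
      by (auto simp: inj_on_def base_def)
    show "compact_space (product_topology (\<lambda>_::'x. subtopology T K) UNIV)"
      using K(2) by (simp add: compact_space_product_topology compact_space_subtopology)
    show "Hausdorff_space (product_topology (\<lambda>_::'x. subtopology T K) UNIV)"
      using top(2) by (simp add: Hausdorff_space_product_topology Hausdorff_space_subtopology)
    fix g assume "g \<in> carrier (W\<lparr>carrier := D\<rparr>)"
    then have "g \<in> carrier W" using subgroup.subset[OF D(1)] by auto
    then obtain f p where g: "g = (f, p)" "\<And>x. f x \<in> carrier H" "p \<in> carrier P"
      by (cases g) auto
    let ?\<psi> = "\<lambda>m x. f x \<otimes>\<^bsub>H\<^esub> m (act p x) \<otimes>\<^bsub>H\<^esub> inv\<^bsub>H\<^esub> f x"
    show "\<exists>\<psi>. continuous_map (product_topology (\<lambda>_::'x. subtopology T K) UNIV)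
            (product_topology (\<lambda>_::'x. subtopology T K) UNIV) \<psi> \<and>
          (\<forall>m\<in>carrier (product_group UNIV (\<lambda>_::'x. H\<lparr>carrier := K\<rparr>)).
            g \<otimes>\<^bsub>W\<lparr>carrier := D\<rparr>\<^esub> base m = base (\<psi> m) \<otimes>\<^bsub>W\<lparr>carrier := D\<rparr>\<^esub> g)"
    proof (intro exI conjI ballI)
      show "continuous_map (product_topology (\<lambda>_::'x. subtopology T K) UNIV)
            (product_topology (\<lambda>_::'x. subtopology T K) UNIV) ?\<psi>"
        unfolding continuous_map_componentwise_UNIV
      proof
        fix x
        show "continuous_map (product_topology (\<lambda>_::'x. subtopology T K) UNIV) (subtopology T K) (\<lambda>m. ?\<psi> m x)"
          using continuous_map_compose[OF continuous_map_product_projection[of "act p x" UNIV "\<lambda>_. subtopology T K"]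
              continuous_map_conjugation_subgroup[OF K(1) g(2)[of x]]]
          by (simp add: o_def)
      qed
      fix m assume "m \<in> carrier (product_group UNIV (\<lambda>_::'x. H\<lparr>carrier := K\<rparr>))"
      then have "m x \<in> carrier H" for x using KH by auto
      then show "g \<otimes>\<^bsub>W\<lparr>carrier := D\<rparr>\<^esub> base m = base (?\<psi> m) \<otimes>\<^bsub>W\<lparr>carrier := D\<rparr>\<^esub> g"
        using g by (simp add: base_def act_one H.m_assoc)
    qed
  qed
qed

lemma bij_conjugate:
  assumes "bij e" "bij h" shows "bij (e \<circ> h \<circ> Hilbert_Choice.inv e)"
  using assms by (intro bij_comp bij_imp_bij_inv)

lemma (in group) ex_coset_enumeration:
  assumes "subgroup K G" "countable (carrier (G Mod K))"
  obtains r :: "nat \<Rightarrow> 'a" where "\<And>i. r i \<in> carrier G"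
    and "\<And>h. h \<in> carrier G \<Longrightarrow> \<exists>k\<in>K. \<exists>i. h = k \<otimes> r i"
proof -
  define R where "R = from_nat_into (carrier (G Mod K))"
  have range: "range R = carrier (G Mod K)"
    unfolding R_def by (intro range_from_nat_into assms) (auto simp: carrier_FactGroup)
  then have "\<forall>i. \<exists>x\<in>carrier G. R i = K #> x"
    by (metis (no_types, lifting) carrier_FactGroup imageE rangeI)
  then obtain r where r: "\<And>i. r i \<in> carrier G" "\<And>i. R i = K #> r i" by metis
  have "\<exists>k\<in>K. \<exists>i. h = k \<otimes> r i" if h: "h \<in> carrier G" for h
  proof -
    have "K #> h \<in> range R" using h by (simp add: range carrier_FactGroup)
    then obtain i where "K #> h = K #> r i" using r by auto
    then have "h \<in> K #> r i" using rcos_self[OF h assms(1)] by simp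
    then show ?thesis by (auto simp: r_coset_def)
  qed
  with r(1) show thesis by (rule that)
qed

section \<open>The embedding\<close>

theorem proposition1p5:
  fixes H :: "('a, 'b) monoid_scheme" and T\<^sub>H :: "'a topology" and K :: "'a set"
  assumes "locally_compact_group H T\<^sub>H"
    and "K \<lhd> H" and "compactin T\<^sub>H K"
    and "discrete_quotient H T\<^sub>H K" and "countable (carrier (H Mod K))"
  shows "\<exists>(G :: 'a ambient monoid) T\<^sub>G L C \<phi>.
           locally_compact_group G T\<^sub>G \<and>
           L \<lhd> G \<and> compactin T\<^sub>G L \<and>
           discrete_quotient G T\<^sub>G L \<and> finitely_generated_group (G Mod L) \<and>
           closed_subgroup C G T\<^sub>G \<and>
           \<phi> \<in> topological_group_iso H T\<^sub>H (G\<lparr>carrier := C\<rparr>) (subtopology T\<^sub>G C)"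
proof -
  interpret H: locally_compact_group H T\<^sub>H by fact
  have sK: "subgroup K H" using assms(2) by (rule normal_imp_subgroup)
  have KH: "K \<subseteq> carrier H" using sK by (rule subgroup.subset)
  have oK: "openin T\<^sub>H K" using H.openin_of_discrete_quotient[OF sK assms(4)] .
  obtain r :: "nat \<Rightarrow> 'a" where r: "\<And>i. r i \<in> carrier H"
    and cosets: "\<And>h. h \<in> carrier H \<Longrightarrow> \<exists>k\<in>K. \<exists>i. h = k \<otimes>\<^bsub>H\<^esub> r i"
    using H.ex_coset_enumeration[OF sK assms(5)] by blast
  \<comment> \<open>The index set \<open>\<nat>\<close> is given coordinates in \<open>\<int> \<times> \<int>\<close>.\<close>
  have "infinite (UNIV :: (int \<times> int) set)"
    by (simp add: finite_prod infinite_UNIV_int)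
  then have e: "bij (to_nat_on (UNIV :: (int \<times> int) set))"
    by (intro to_nat_on_infinite) auto
  define e :: "int \<times> int \<Rightarrow> nat" where "e = to_nat_on UNIV"
  have e: "bij e" using e by (simp add: e_def)
  have inv_e [simp]: "Hilbert_Choice.inv e (e y) = y" for y
    using e by (simp add: bij_def)
  define \<sigma> where "\<sigma> = e \<circ> (\<lambda>(i, n). (i + 1, n)) \<circ> Hilbert_Choice.inv e"
  define \<tau> where "\<tau> = e \<circ> (\<lambda>(i, n). (i, if i = 0 then n + 1 else n)) \<circ> Hilbert_Choice.inv e"
  have "bij (\<lambda>(i::int, n::int). (i + 1, n))"
    by (rule o_bij[of "\<lambda>(i, n). (i - 1, n)"]) auto
  moreover have "bij (\<lambda>(i::int, n::int). (i, if i = 0 then n + 1 else n))"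
    by (rule o_bij[of "\<lambda>(i, n). (i, if i = 0 then n - 1 else n)"]) auto
  ultimately have bij: "bij g" if "g \<in> {\<sigma>, \<tau>}" for g
    using that bij_conjugate[OF e] unfolding \<sigma>_def \<tau>_def by blast
  have "countable {\<sigma>, \<tau>}" by simp
  from ex_countable_permutation_action[OF this bij]
  obtain P :: "nat monoid" and act where P: "group P"
    and act: "\<And>p q. p \<in> carrier P \<Longrightarrow> q \<in> carrier P \<Longrightarrow> act (p \<otimes>\<^bsub>P\<^esub> q) = act q \<circ> act p"
      "act \<one>\<^bsub>P\<^esub> = id" "{\<sigma>, \<tau>} \<subseteq> act ` carrier P"
    by blast
  obtain s t where st: "s \<in> carrier P" "t \<in> carrier P" "act s = \<sigma>" "act t = \<tau>"
    using act(3) by auto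
  interpret P: group P by (rule P)
  interpret wreath H P act by unfold_locales (use act in auto)
  \<comment> \<open>On the right half of row \<open>i\<close> the value is the \<open>i\<close>-th coset representative; \<open>nat\<close> sends all rows of
    negative index to the representative \<open>r 0\<close>, and only the rows \<open>i \<ge> 0\<close> are moved to row \<open>0\<close>
    below.\<close>
  define f where "f x = (case Hilbert_Choice.inv e x of (i, n) \<Rightarrow>
      if n > 0 then r (nat i) else \<one>\<^bsub>H\<^esub>)" for x
  have fH: "f x \<in> carrier H" for x using r by (simp add: f_def split: prod.split)
  define M where "M = product_group (UNIV :: nat set) (\<lambda>_. H\<lparr>carrier := K\<rparr>)"
  define S where "S = product_topology (\<lambda>_::nat. subtopology T\<^sub>H K) UNIV"
  have M: "carrier M = {m. \<forall>x. m x \<in> K}" by (auto simp: M_def)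
  define B where "B = {base f, (\<lambda>_. \<one>\<^bsub>H\<^esub>, s), (\<lambda>_. \<one>\<^bsub>H\<^esub>, t)}"
  define D where "D = generate W (base ` carrier M \<union> B)"
  have BW: "base ` carrier M \<union> B \<subseteq> carrier W"
  proof -
    have "m x \<in> carrier H" if "m \<in> carrier M" for m x
      using that KH unfolding M by blast
    then show ?thesis using fH st by (auto simp: B_def base_def)
  qed
  have D: "subgroup D W" unfolding D_def by (rule W.generate_is_subgroup[OF BW])
  have sub_D: "base ` carrier M \<union> B \<subseteq> D" unfolding D_def by (auto intro: generate.incl)
  define G where "G = W\<lparr>carrier := D\<rparr>"
  interpret compact_normal_embedding G M S base
    unfolding G_def M_def S_def
    by (rule compact_normal_embedding_base[OF H.topological_group_axioms H.Hausdorff assms(2,3) D])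
      (use sub_D in \<open>auto simp: M\<close>)
  define z where "z = e (0, 0)"
  define \<kappa> where "\<kappa> k = (\<lambda>_. \<one>\<^bsub>H\<^esub>)(z := k)" for k
  have "\<one>\<^bsub>H\<^esub> \<in> K" using sK by (rule subgroup.one_closed)
  then have \<kappa>M: "\<kappa> k \<in> carrier M" if "k \<in> K" for k
    using that by (auto simp: M \<kappa>_def)
  have single_r: "single z (r i) \<in> D" for i
    unfolding z_def
    by (rule single_mem_subgroup[OF e st(1,2), where f = f])
      (use r sub_D D in \<open>auto simp: st \<sigma>_def \<tau>_def f_def B_def\<close>)
  \<comment> \<open>A coset representative at the point \<open>z\<close>, times an element of \<open>L\<close> supported at \<open>z\<close>.\<close>
  have single_D: "single z h \<in> D" if "h \<in> carrier H" for h
  proof -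
    obtain k i where k: "k \<in> K" "h = k \<otimes>\<^bsub>H\<^esub> r i" using cosets \<open>h \<in> carrier H\<close> by blast
    then have "single z h = base (\<kappa> k) \<otimes>\<^bsub>W\<^esub> single z (r i)"
      using hom_mult[OF single_hom, of k "r i" z] KH r by (auto simp: single_def \<kappa>_def)
    then show ?thesis
      using sub_D \<kappa>M[OF k(1)] single_r by (auto intro: subgroup.m_closed[OF D])
  qed
  have "single z \<in> hom H G"
    using single_hom[of z] single_D by (auto simp: hom_def G_def)
  moreover have "continuous_map (subtopology T\<^sub>H K) S \<kappa>"
    unfolding S_def continuous_map_componentwise_UNIV
  proof
    fix x show "continuous_map (subtopology T\<^sub>H K) (subtopology T\<^sub>H K) (\<lambda>k. \<kappa> k x)"
      using \<open>\<one>\<^bsub>H\<^esub> \<in> K\<close> by (cases "x = z") (auto simp: \<kappa>_def H.topspace_eq)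
  qed
  moreover have "h \<in> K" if "single z h \<in> L" for h
  proof -
    from that obtain m where "m \<in> carrier M" "single z h = base m" by auto
    then show ?thesis by (auto simp: single_def base_def M fun_eq_iff split: if_splits)
  qed
  ultimately have emb: "closed_subgroup (single z ` carrier H) G ext_topology \<and>
    single z \<in> topological_group_iso H T\<^sub>H (G\<lparr>carrier := single z ` carrier H\<rparr>)
          (subtopology ext_topology (single z ` carrier H))"
    by (intro closed_embedding_ext[OF H.topological_group_axioms oK assms(3) sK, where \<kappa> = \<kappa>] inj_single)
      (auto simp: single_def \<kappa>_def)
  have "finitely_generated_group (G Mod L)"
  proof (rule finitely_generated_Mod[OF normal_L])
    show "finite B" "B \<subseteq> carrier G" using sub_D by (auto simp: B_def G_def)
    show "carrier G = generate G (L \<union> B)"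
      using W.generate_consistent[OF sub_D D] by (simp add: G_def D_def)
  qed
  then show ?thesis
    using locally_compact_group_ext normal_L compactin_L discrete_quotient_ext emb by blast
qed

end
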